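(* Let $p_1,\dots,p_n$ be $p$-values for null hypotheses $H_1,\dots,H_n$ with fixed covariates $x_1,\dots,x_n$, and let $\mathcal{H}_0=\{i: H_i \text{ is true}\}$. Assume that the null $p$-values $(p_i)_{i\in\mathcal{H}_0}$ are mutually independent and independent of the non-null $p$-values $(p_i)_{i\notin\mathcal{H}_0}$, and assume that each null $p$-value has a non-decreasing density on $[0,1]$. Then, for any masking parameters $0<\alpha_m\le\lambda<\nu\le 1$, any target level $\alpha\in(0,1)$, and any adaptive rule for shrinking the masking set, the $\mathrm{AdaPT}_g$ procedure (defined in the context) controls the false discovery rate at the target level $\alpha$, i.e. $\mathrm{FDR}\le\alpha$.
   Context: Covariates $x_1,\dots,x_n$ are fixed (non-random). Fix $0<\alpha_m\le\lambda<\nu\le1$ and set $\zeta=(\nu-\lambda)/\alpha_m$. The masking function is $g(p)=(\nu-p)/\zeta$ for $p\in[\lambda,\nu]$ and $g(p)=p$ otherwise. Put $m_i=g(p_i)$ (the masked $p$-value) and $b_i=\mathbf{1}\{p_i\in[\lambda,\nu]\}$; the pair $(m_i,b_i)$ determines $p_i$. The $\mathrm{AdaPT}_g$ procedure: Initialize the masking set $\mathcal{M}_0=\{i\in[n]: p_i\in[0,\alpha_m]\cup[\lambda,\nu]\}$ (equivalently $\{i: m_i\le\alpha_m\}$). For $t=0,1,2,\dots$ let $$R_t=|\{i\in\mathcal{M}_t: 0\le p_i\le\alpha_m\}|,\qquad A_t=|\{i\in\mathcal{M}_t:\lambda\le p_i\le\nu\}|,\qquad \widehat{\mathrm{FDP}}_t=\frac{1+A_t}{\zeta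 R_t}.$$ If $R_t>0$ and $\widehat{\mathrm{FDP}}_t\le\alpha$, the procedure stops and rejects all $H_i$ with $i\in\mathcal{M}_t$ and $p_i\le\alpha_m$. Otherwise, if $\mathcal{M}_t\neq\emptyset$, the analyst chooses a strictly smaller set $\mathcal{M}_{t+1}\subsetneq\mathcal{M}_t$ by any (measurable) rule depending only on the information available at step $t$, namely $(x_i,m_i)_{i\in[n]}$, $A_t$, $R_t$, $\mathcal{M}_t$, and $\{p_i: i\notin\mathcal{M}_t\}$ (equivalently $\{b_i:i\notin\mathcal{M}_t\}$). If $\mathcal{M}_t=\emptyset$ is reached without stopping, no rejections are made. (Equivalently, one may describe the procedure by decreasing thresholds $s_0\equiv\alpha_m\ge s_1(x)\ge s_2(x)\ge\cdots$, with $\mathcal{M}_t=\{i:m_i\le s_t(x_i)\}$.) If $R$ is the total number of rejections and $V$ the number of rejected $H_i$ with $i\in\mathcal{H}_0$, the false discovery rate is $\mathrm{FDR}=\mathbb{E}[V/\max\{R,1\}]$. *)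

theory Defs
  imports "HOL-Probability.Probability"
begin

definition zeta :: "real \<Rightarrow> real \<Rightarrow> real \<Rightarrow> real" where
  "zeta \<alpha>\<^sub>m lam \<nu> = (\<nu> - lam) / \<alpha>\<^sub>m"

definition masking_fun :: "real \<Rightarrow> real \<Rightarrow> real \<Rightarrow> real \<Rightarrow> real" where
  "masking_fun \<alpha>\<^sub>m lam \<nu> u = (if u \<in> {lam..\<nu>} then (\<nu> - u) / zeta \<alpha>\<^sub>m lam \<nu> else u)"

text \<open>
  In the following, \<open>q\<close> is a realised vector of p-values \<open>q 1, \<dots>, q n\<close> and \<open>S\<close> a masking set.
  If \<open>\<alpha>\<^sub>m = lam\<close>, the point \<open>lam\<close> is counted both by \<open>num_R\<close> and by \<open>num_A\<close>.
\<close>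

definition initial_mask :: "nat \<Rightarrow> real \<Rightarrow> real \<Rightarrow> real \<Rightarrow> (nat \<Rightarrow> real) \<Rightarrow> nat set" where
  "initial_mask n \<alpha>\<^sub>m lam \<nu> q = {i \<in> {1..n}. q i \<in> {0..\<alpha>\<^sub>m} \<union> {lam..\<nu>}}"

definition num_R :: "real \<Rightarrow> (nat \<Rightarrow> real) \<Rightarrow> nat set \<Rightarrow> nat" where
  "num_R \<alpha>\<^sub>m q S = card {i \<in> S. 0 \<le> q i \<and> q i \<le> \<alpha>\<^sub>m}"

definition num_A :: "real \<Rightarrow> real \<Rightarrow> (nat \<Rightarrow> real) \<Rightarrow> nat set \<Rightarrow> nat" where
  "num_A lam \<nu> q S = card {i \<in> S. lam \<le> q i \<and> q i \<le> \<nu>}"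

definition fdp_hat :: "real \<Rightarrow> real \<Rightarrow> real \<Rightarrow> (nat \<Rightarrow> real) \<Rightarrow> nat set \<Rightarrow> real" where
  "fdp_hat \<alpha>\<^sub>m lam \<nu> q S =
     (1 + real (num_A lam \<nu> q S)) / (zeta \<alpha>\<^sub>m lam \<nu> * real (num_R \<alpha>\<^sub>m q S))"

definition stops :: "real \<Rightarrow> real \<Rightarrow> real \<Rightarrow> real \<Rightarrow> (nat \<Rightarrow> real) \<Rightarrow> nat set \<Rightarrow> bool" where
  "stops \<alpha> \<alpha>\<^sub>m lam \<nu> q S \<longleftrightarrow> num_R \<alpha>\<^sub>m q S > 0 \<and> fdp_hat \<alpha>\<^sub>m lam \<nu> q S \<le> \<alpha>"

text \<open>
  A shrinking rule maps the step \<open>t\<close>, the covariates, the masked p-values, the counts \<open>A\<^sub>t\<close> and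
  \<open>R\<^sub>t\<close>, the current masking set, and the p-values outside the masking set to the next masking
  set.  It sees data only through restricted functions, so it has no access to anything else.
  Earlier masking sets and counts need not be passed: for a fixed rule they can be recomputed
  from these arguments.
\<close>

type_synonym 'x shrinking_rule =
  "nat \<Rightarrow> (nat \<Rightarrow> 'x) \<Rightarrow> (nat \<Rightarrow> real) \<Rightarrow> nat \<Rightarrow> nat \<Rightarrow> nat set \<Rightarrow> (nat \<Rightarrow> real) \<Rightarrow> nat set"

text \<open>
  The codomain \<open>count_space {T. T \<subset> S}\<close> expresses both measurability and strict shrinking.  The
  covariates are non-random, so no measurability in them is required.
\<close>

definition adaptive_rule :: "nat \<Rightarrow> (nat \<Rightarrow> 'x) \<Rightarrow> 'x shrinking_rule \<Rightarrow> bool" where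
  "adaptive_rule n x rule \<longleftrightarrow>
     (\<forall>t A R S. S \<subseteq> {1..n} \<longrightarrow> S \<noteq> {} \<longrightarrow>
        (\<lambda>(m, u). rule t (restrict x {1..n}) m A R S u)
          \<in> (\<Pi>\<^sub>M i\<in>{1..n}. (borel :: real measure)) \<Otimes>\<^sub>M (\<Pi>\<^sub>M i\<in>{1..n} - S. (borel :: real measure))
            \<rightarrow>\<^sub>M count_space {T. T \<subset> S})"

text \<open>
  The recursion is continued past the stopping step; only the masking set at the first stopping
  step enters \<open>rejections\<close>.
\<close>

primrec masking_set ::
  "nat \<Rightarrow> real \<Rightarrow> real \<Rightarrow> real \<Rightarrow> (nat \<Rightarrow> 'x) \<Rightarrow> 'x shrinking_rule \<Rightarrow> (nat \<Rightarrow> real) \<Rightarrow> nat \<Rightarrow> nat set"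
where
  "masking_set n \<alpha>\<^sub>m lam \<nu> x rule q 0 = initial_mask n \<alpha>\<^sub>m lam \<nu> q"
| "masking_set n \<alpha>\<^sub>m lam \<nu> x rule q (Suc t) =
     (let S = masking_set n \<alpha>\<^sub>m lam \<nu> x rule q t in
        if S = {} then {}
        else rule t (restrict x {1..n}) (restrict (\<lambda>i. masking_fun \<alpha>\<^sub>m lam \<nu> (q i)) {1..n})
               (num_A lam \<nu> q S) (num_R \<alpha>\<^sub>m q S) S (restrict q ({1..n} - S)))"

definition rejections ::
  "nat \<Rightarrow> real \<Rightarrow> real \<Rightarrow> real \<Rightarrow> real \<Rightarrow> (nat \<Rightarrow> 'x) \<Rightarrow> 'x shrinking_rule \<Rightarrow> (nat \<Rightarrow> real) \<Rightarrow> nat set"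
where
  "rejections n \<alpha> \<alpha>\<^sub>m lam \<nu> x rule q =
     (let M = masking_set n \<alpha>\<^sub>m lam \<nu> x rule q in
        if \<exists>t. stops \<alpha> \<alpha>\<^sub>m lam \<nu> q (M t)
        then {i \<in> M (LEAST t. stops \<alpha> \<alpha>\<^sub>m lam \<nu> q (M t)). q i \<le> \<alpha>\<^sub>m}
        else {})"

definition FDR :: "'w measure \<Rightarrow> nat set \<Rightarrow> ('w \<Rightarrow> nat set) \<Rightarrow> real" where
  "FDR M H0 Rej =
     (\<integral>\<omega>. real (card (Rej \<omega> \<inter> H0)) / real (max (card (Rej \<omega>)) 1) \<partial>M)"

text \<open>
  The density takes extended values so that densities tending to infinity at the right end point,
  such as that of the Beta(1, 1/2) distribution, are covered by \<open>mono_on {0..1}\<close>.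
\<close>

definition has_nondecreasing_density :: "'w measure \<Rightarrow> ('w \<Rightarrow> real) \<Rightarrow> bool" where
  "has_nondecreasing_density M X \<longleftrightarrow>
     (\<exists>f :: real \<Rightarrow> ennreal. mono_on {0..1} f \<and>
        distributed M lborel X (\<lambda>u. f u * indicator {0..1} u))"

end

theory Submission
  imports Defs
begin

text \<open>
  At the stopping time \<open>\<tau>\<close> the false discovery proportion is at most
  \<open>\<alpha> \<zeta> V / (1 + A\<^sub>\<tau>)\<close>.  Charge \<open>1 / (1 + A\<^sub>\<tau>)\<close> to each rejected null \<open>i\<close>.  Since \<open>p\<^sub>i\<close> is
  independent of the other p-values and its density is non-decreasing, \<open>\<zeta>\<close> times the expected
  charge to \<open>i\<close> is at most the expectation, over the event \<open>p\<^sub>i \<in> (lam, \<nu>]\<close>, of the charge computed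
  after replacing \<open>p\<^sub>i\<close> by its masked value.  For a fixed vector \<open>q\<close>, the vectors obtained by
  replacing a single coordinate in this way are indistinguishable to the analyst for as long as
  the replaced indices are masked.  Hence all those with a positive charge stop
  at the same masking set, where each has one upper p-value less than \<open>q\<close>.  So each charge is
  \<open>1 / A\<close>, where \<open>A\<close> is the number of upper p-values of \<open>q\<close> in this set, and there are at most \<open>A\<close>
  of them: the charges sum to at most 1.
\<close>

section \<open>The procedure run on one fixed vector of p-values\<close>

locale masking_procedure =
  fixes n :: nat and \<alpha> \<alpha>\<^sub>m lam \<nu> :: real and x :: "nat \<Rightarrow> 'x" and rule :: "'x shrinking_rule"
  assumes alpha_m_pos: "0 < \<alpha>\<^sub>m" and alpha_m_le: "\<alpha>\<^sub>m \<le> lam" and lam_less: "lam < \<nu>"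
    and adaptive: "adaptive_rule n x rule"
begin

abbreviation \<zeta> :: real where "\<zeta> \<equiv> zeta \<alpha>\<^sub>m lam \<nu>"
abbreviation reflect :: "real \<Rightarrow> real" where "reflect \<equiv> masking_fun \<alpha>\<^sub>m lam \<nu>"
abbreviation mask :: "(nat \<Rightarrow> real) \<Rightarrow> nat \<Rightarrow> nat set" where
  "mask \<equiv> masking_set n \<alpha>\<^sub>m lam \<nu> x rule"
abbreviation stops_at :: "(nat \<Rightarrow> real) \<Rightarrow> nat \<Rightarrow> bool" where
  "stops_at q t \<equiv> stops \<alpha> \<alpha>\<^sub>m lam \<nu> q (mask q t)"

definition stop_time :: "(nat \<Rightarrow> real) \<Rightarrow> nat" where
  "stop_time q = (LEAST t. stops_at q t)"

definition final_mask :: "(nat \<Rightarrow> real) \<Rightarrow> nat set" where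
  "final_mask q = mask q (stop_time q)"

text \<open>Without a stopping step \<open>stop_time\<close> is an unspecified number, so the value
  is then set to 0. The lower bound 0 on \<open>q i\<close> makes the charge vanish off
  \<open>{0..\<alpha>\<^sub>m}\<close>, as \<open>nn_integral_reflect\<close> demands of its
  integrand.\<close>

definition credit :: "nat \<Rightarrow> (nat \<Rightarrow> real) \<Rightarrow> real" where
  "credit i q =
     (if (\<exists>t. stops_at q t) \<and> i \<in> final_mask q \<and> q i \<in> {0..\<alpha>\<^sub>m}
      then 1 / (1 + real (num_A lam \<nu> q (final_mask q))) else 0)"

lemma zeta_pos: "0 < \<zeta>"
  using alpha_m_pos lam_less by (simp add: zeta_def)

text \<open>The point \<open>lam\<close> is left out because its reflection is
  \<open>\<alpha>\<^sub>m\<close>: if \<open>\<alpha>\<^sub>m = lam\<close>, it would still count as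
  an upper value after reflection, and \<open>num_reflected\<close> would fail.\<close>

lemma reflect_upper:
  assumes "u \<in> {lam<..\<nu>}"
  shows "reflect u = (\<nu> - u) / \<zeta>" "0 \<le> reflect u" "reflect u < \<alpha>\<^sub>m"
  using assms zeta_pos alpha_m_pos lam_less
  by (auto simp: masking_fun_def zeta_def field_simps)

text \<open>A reflected value lies below \<open>\<alpha>\<^sub>m \<le> lam\<close>, where masking is
  the identity. Hence reflecting a coordinate leaves the masked p-values seen by the analyst
  unchanged.\<close>

lemma reflect_reflect:
  assumes "u \<in> {lam<..\<nu>}"
  shows "reflect (reflect u) = reflect u"
  using reflect_upper[OF assms] alpha_m_le by (subst masking_fun_def) auto

text \<open>Strict shrinking is contained in the codomain of the measurability assumption.
  Restricting \<open>m\<close> and \<open>u\<close> makes them points of the product spaces, so that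
  \<open>measurable_space\<close> applies.\<close>

lemma rule_strict:
  assumes "S \<subseteq> {1..n}" "S \<noteq> {}"
  shows "rule t (restrict x {1..n}) (restrict m {1..n}) A R S (restrict u ({1..n} - S)) \<subset> S"
proof -
  have *: "(\<lambda>(m, u). rule t (restrict x {1..n}) m A R S u)
      \<in> (\<Pi>\<^sub>M i\<in>{1..n}. (borel :: real measure)) \<Otimes>\<^sub>M (\<Pi>\<^sub>M i\<in>{1..n} - S. (borel :: real measure))
        \<rightarrow>\<^sub>M count_space {T. T \<subset> S}"
    using adaptive assms unfolding adaptive_rule_def by blast
  have "(restrict m {1..n}, restrict u ({1..n} - S)) \<in> space
      ((\<Pi>\<^sub>M i\<in>{1..n}. (borel :: real measure)) \<Otimes>\<^sub>M (\<Pi>\<^sub>M i\<in>{1..n} - S. (borel :: real measure)))"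
    by (simp add: space_pair_measure space_PiM)
  from measurable_space[OF * this] show ?thesis by simp
qed

lemma mask_subset: "mask q t \<subseteq> {1..n}"
proof (induction t)
  case 0
  then show ?case by (auto simp: initial_mask_def)
next
  case (Suc t)
  then show ?case
    using rule_strict[OF Suc] by (simp add: Let_def) (meson order_trans psubset_imp_subset)
qed

lemma finite_mask: "finite (mask q t)"
  using mask_subset finite_subset by blast

lemma mask_Suc_subset: "mask q (Suc t) \<subseteq> mask q t"
  using rule_strict[OF mask_subset] by (simp add: Let_def psubset_imp_subset)

lemma mask_antimono: "s \<le> t \<Longrightarrow> mask q t \<subseteq> mask q s"
  by (induction rule: dec_induct) (use mask_Suc_subset in blast)+

text \<open>The assumptions list what the rule can see. The vectors may still differ at masked
  coordinates, which is what the comparison of reflected vectors exploits.\<close>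

lemma mask_Suc_cong:
  assumes "mask q' t = mask q t"
    and "\<And>i. i \<in> {1..n} \<Longrightarrow> reflect (q' i) = reflect (q i)"
    and "\<And>i. i \<in> {1..n} - mask q t \<Longrightarrow> q' i = q i"
    and "num_A lam \<nu> q' (mask q t) = num_A lam \<nu> q (mask q t)"
    and "num_R \<alpha>\<^sub>m q' (mask q t) = num_R \<alpha>\<^sub>m q (mask q t)"
  shows "mask q' (Suc t) = mask q (Suc t)"
proof -
  have "restrict (\<lambda>i. reflect (q' i)) {1..n} = restrict (\<lambda>i. reflect (q i)) {1..n}"
    "restrict q' ({1..n} - mask q t) = restrict q ({1..n} - mask q t)"
    using assms(2,3) by (auto simp: restrict_def fun_eq_iff)
  then show ?thesis using assms(1,4,5) by (simp add: Let_def)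
qed

lemma num_cong:
  assumes "\<And>i. i \<in> S \<Longrightarrow> q' i = q i"
  shows "num_A lam \<nu> q' S = num_A lam \<nu> q S" "num_R \<alpha>\<^sub>m q' S = num_R \<alpha>\<^sub>m q S"
proof -
  have "{i \<in> S. lam \<le> q' i \<and> q' i \<le> \<nu>} = {i \<in> S. lam \<le> q i \<and> q i \<le> \<nu>}"
    "{i \<in> S. 0 \<le> q' i \<and> q' i \<le> \<alpha>\<^sub>m} = {i \<in> S. 0 \<le> q i \<and> q i \<le> \<alpha>\<^sub>m}"
    using assms by auto
  then show "num_A lam \<nu> q' S = num_A lam \<nu> q S" "num_R \<alpha>\<^sub>m q' S = num_R \<alpha>\<^sub>m q S"
    by (simp_all add: num_A_def num_R_def)
qed

text \<open>The theorem runs the procedure on an unrestricted function, whereas points of the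
  product space are restricted to \<open>{1..n}\<close>. This and the next two lemmas allow passing
  between them.\<close>

lemma mask_cong:
  assumes "\<And>i. i \<in> {1..n} \<Longrightarrow> q' i = q i"
  shows "mask q' t = mask q t"
proof (induction t)
  case 0
  then show ?case using assms by (auto simp: initial_mask_def)
next
  case (Suc t)
  have "q' i = q i" if "i \<in> mask q t" for i
    using assms mask_subset that by blast
  with Suc assms show ?case by (intro mask_Suc_cong num_cong) auto
qed

lemma stops_at_cong:
  assumes "\<And>i. i \<in> {1..n} \<Longrightarrow> q' i = q i"
  shows "stops_at q' t = stops_at q t"
proof -
  have "q' i = q i" if "i \<in> mask q t" for i
    using assms mask_subset that by blast
  then have "num_A lam \<nu> q' (mask q t) = num_A lam \<nu> q (mask q t)"
    "num_R \<alpha>\<^sub>m q' (mask q t) = num_R \<alpha>\<^sub>m q (mask q t)"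
    using num_cong[of "mask q t" q' q] by blast+
  moreover have "mask q' t = mask q t" by (rule mask_cong) (rule assms)
  ultimately show ?thesis
    by (simp add: stops_def fdp_hat_def)
qed

lemma credit_cong:
  assumes "\<And>i. i \<in> {1..n} \<Longrightarrow> q' i = q i"
  shows "credit i q' = credit i q"
proof -
  have st: "stops_at q' t = stops_at q t" and m: "mask q' t = mask q t" for t
    using stops_at_cong[of q' q t] mask_cong[of q' q t] assms by blast+
  have "stop_time q' = stop_time q" by (simp only: stop_time_def st)
  then have f: "final_mask q' = final_mask q" by (simp only: final_mask_def m)
  have "q' i = q i" if "i \<in> final_mask q" for i
    using assms mask_subset that unfolding final_mask_def by blast
  moreover from this have "num_A lam \<nu> q' (final_mask q) = num_A lam \<nu> q (final_mask q)"
    by (rule num_cong)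
  ultimately show ?thesis
    unfolding credit_def f st by (cases "i \<in> final_mask q") simp_all
qed

section \<open>Runs on vectors with one reflected coordinate\<close>

lemma num_reflected:
  assumes "finite S" "i \<in> S" "q i \<in> {lam<..\<nu>}"
  shows "num_A lam \<nu> q S = Suc (num_A lam \<nu> (q(i := reflect (q i))) S)"
    and "num_R \<alpha>\<^sub>m (q(i := reflect (q i))) S = Suc (num_R \<alpha>\<^sub>m q S)"
proof -
  have "{j \<in> S. lam \<le> q j \<and> q j \<le> \<nu>} =
      insert i {j \<in> S. lam \<le> (q(i := reflect (q i))) j \<and> (q(i := reflect (q i))) j \<le> \<nu>}"
    "{j \<in> S. 0 \<le> (q(i := reflect (q i))) j \<and> (q(i := reflect (q i))) j \<le> \<alpha>\<^sub>m} =
      insert i {j \<in> S. 0 \<le> q j \<and> q j \<le> \<alpha>\<^sub>m}"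
    using assms reflect_upper[OF assms(3)] alpha_m_le by auto
  then show "num_A lam \<nu> q S = Suc (num_A lam \<nu> (q(i := reflect (q i))) S)"
    "num_R \<alpha>\<^sub>m (q(i := reflect (q i))) S = Suc (num_R \<alpha>\<^sub>m q S)"
    using assms reflect_upper[OF assms(3)] alpha_m_le by (simp_all add: num_A_def num_R_def)
qed

text \<open>While \<open>i\<close> and \<open>j\<close> are masked, the two vectors differ only at
  masked coordinates and have the same masked values. Each arises from \<open>q\<close> by moving
  one index of the current set from the upper to the lower side, so both counts agree as
  well.\<close>

lemma reflected_runs_agree:
  fixes q i j
  defines "qi \<equiv> q(i := reflect (q i))" and "qj \<equiv> q(j := reflect (q j))"
  assumes up: "q i \<in> {lam<..\<nu>}" "q j \<in> {lam<..\<nu>}"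
    and "\<And>s. s < t \<Longrightarrow> i \<in> mask qi s" "\<And>s. s < t \<Longrightarrow> j \<in> mask qj s"
  shows "mask qi t = mask qj t"
  using assms(5,6)
proof (induction t)
  \<comment> \<open>Upper values and their reflections both belong to the initial mask.\<close>
  case 0
  show ?case
    using reflect_upper[OF up(1)] reflect_upper[OF up(2)] up
    by (auto simp: initial_mask_def qi_def qj_def)
next
  case (Suc t)
  let ?S = "mask qj t"
  have eq: "mask qi t = ?S" using Suc by auto
  have ij: "i \<in> ?S" "j \<in> ?S" using Suc.prems[of t] eq by auto
  show ?case
  proof (rule mask_Suc_cong[OF eq])
    show "reflect (qi k) = reflect (qj k)" for k
      using reflect_reflect[OF up(1)] reflect_reflect[OF up(2)] by (auto simp: qi_def qj_def)
    show "qi k = qj k" if "k \<in> {1..n} - ?S" for k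
      using that ij by (auto simp: qi_def qj_def)
    show "num_A lam \<nu> qi ?S = num_A lam \<nu> qj ?S"
      using num_reflected(1)[of ?S i q, OF finite_mask ij(1) up(1)]
        num_reflected(1)[of ?S j q, OF finite_mask ij(2) up(2)]
      by (simp add: qi_def qj_def)
    show "num_R \<alpha>\<^sub>m qi ?S = num_R \<alpha>\<^sub>m qj ?S"
      using num_reflected(2)[of ?S i q, OF finite_mask ij(1) up(1)]
        num_reflected(2)[of ?S j q, OF finite_mask ij(2) up(2)]
      by (simp add: qi_def qj_def)
  qed
qed

text \<open>At the earlier stopping time both indices are still masked, so the runs coincide there
  and have equal counts. The stopping criterion depends on the counts only; hence the other run
  stops there too.\<close>

lemma reflected_final_mask_if_stop_time_le:
  fixes q i j
  defines "qi \<equiv> q(i := reflect (q i))" and "qj \<equiv> q(j := reflect (q j))"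
  assumes up: "q i \<in> {lam<..\<nu>}" "q j \<in> {lam<..\<nu>}"
    and ex: "\<exists>t. stops_at qi t"
    and mem: "i \<in> final_mask qi" "j \<in> final_mask qj"
    and le: "stop_time qi \<le> stop_time qj"
  shows "final_mask qi = final_mask qj"
proof -
  let ?t = "stop_time qi"
  \<comment> \<open>Masking sets decrease, so an index in its own final mask was masked at every
    earlier step; for \<open>j\<close>, \<open>le\<close> is what brings the steps up to
    \<open>?t\<close> into range.\<close>
  have i: "i \<in> mask qi s" and j: "j \<in> mask qj s" if "s \<le> ?t" for s
    using mem mask_antimono[of s "stop_time qi" qi] mask_antimono[of s "stop_time qj" qj] that le
    by (auto simp: final_mask_def)
  have eq: "mask qi ?t = mask qj ?t"
    using reflected_runs_agree[OF up, of ?t] i j by (simp add: qi_def qj_def)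
  have ij: "i \<in> mask qj ?t" "j \<in> mask qj ?t"
    using i[of ?t] j[of ?t] eq by simp_all
  have "stops_at qi ?t" using ex unfolding stop_time_def by (rule LeastI_ex)
  moreover have "num_A lam \<nu> qi (mask qj ?t) = num_A lam \<nu> qj (mask qj ?t)"
    "num_R \<alpha>\<^sub>m qi (mask qj ?t) = num_R \<alpha>\<^sub>m qj (mask qj ?t)"
    using num_reflected[of "mask qj ?t" i q, OF finite_mask ij(1) up(1)]
      num_reflected[of "mask qj ?t" j q, OF finite_mask ij(2) up(2)]
    by (simp_all add: qi_def qj_def)
  ultimately have "stops_at qj ?t" using eq by (simp add: stops_def fdp_hat_def)
  then have "stop_time qj \<le> ?t" unfolding stop_time_def[of qj] by (rule Least_le)
  with eq le show ?thesis by (simp add: final_mask_def)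
qed

lemma reflected_final_mask:
  fixes q i j
  defines "qi \<equiv> q(i := reflect (q i))" and "qj \<equiv> q(j := reflect (q j))"
  assumes "q i \<in> {lam<..\<nu>}" "q j \<in> {lam<..\<nu>}"
    and "\<exists>t. stops_at qi t" "\<exists>t. stops_at qj t"
    and "i \<in> final_mask qi" "j \<in> final_mask qj"
  shows "final_mask qi = final_mask qj"
proof (cases "stop_time qi \<le> stop_time qj")
  case True
  with assms show ?thesis by (intro reflected_final_mask_if_stop_time_le[of q i j, folded qi_def qj_def]) auto
next
  case False
  with assms show ?thesis
    by (intro reflected_final_mask_if_stop_time_le[of q j i, folded qi_def qj_def, symmetric]) auto
qed

section \<open>Pointwise bounds on the charges\<close>

lemma credit_nonneg: "0 \<le> credit i q"
  by (simp add: credit_def)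

lemma sum_reflected_credit_le_1:
  assumes "finite H"
  shows "(\<Sum>i\<in>H. indicator {lam<..\<nu>} (q i) * credit i (q(i := reflect (q i)))) \<le> 1"
proof -
  let ?q = "\<lambda>i. q(i := reflect (q i))"
  define I where "I = {i \<in> H. q i \<in> {lam<..\<nu>} \<and> (\<exists>t. stops_at (?q i) t) \<and> i \<in> final_mask (?q i)}"
  have fin: "finite I" using assms by (simp add: I_def)
  have "(\<Sum>i\<in>H. indicator {lam<..\<nu>} (q i) * credit i (?q i)) =
      (\<Sum>i\<in>I. indicator {lam<..\<nu>} (q i) * credit i (?q i))"
    using assms by (intro sum.mono_neutral_right) (auto simp: I_def credit_def indicator_def)
  also have "\<dots> \<le> 1"
  proof (cases "I = {}")
    case False
    then obtain k where k: "k \<in> I" by blast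
    define S where "S = final_mask (?q k)"
    have S: "final_mask (?q i) = S" if "i \<in> I" for i
      using reflected_final_mask[of q i k] that k by (simp add: I_def S_def)
    have finS: "finite S" by (simp add: S_def final_mask_def finite_mask)
    have "I \<subseteq> {i \<in> S. lam \<le> q i \<and> q i \<le> \<nu>}"
      using S by (auto simp: I_def)
    then have card: "card I \<le> num_A lam \<nu> q S"
      using finS by (simp add: num_A_def card_mono)
    \<comment> \<open>By \<open>num_reflected\<close>, one plus the upper count of the reflected
      vector in \<open>S\<close> is the upper count of \<open>q\<close> in \<open>S\<close>, which
      does not depend on \<open>i\<close>.\<close>
    have "credit i (?q i) \<le> 1 / real (num_A lam \<nu> q S)" if "i \<in> I" for i
    proof -
      have "i \<in> S" using S[OF that] that by (auto simp: I_def)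
      then show ?thesis
        using num_reflected(1)[OF finS, of i q] that S[OF that] by (auto simp: credit_def I_def)
    qed
    then have "(\<Sum>i\<in>I. indicator {lam<..\<nu>} (q i) * credit i (?q i))
        \<le> (\<Sum>i\<in>I. 1 / real (num_A lam \<nu> q S))"
      by (intro sum_mono) (simp add: I_def)
    also have "\<dots> \<le> 1" using card by (auto simp: divide_le_eq_1)
    finally show ?thesis .
  qed simp
  finally show ?thesis .
qed

text \<open>Stopping gives 1 / R \<le> \<alpha> \<zeta> / (1 + A), to be multiplied by the number of
  false rejections. Nonnegativity of \<open>q\<close> enters because a rejection asks only for
  \<open>q i \<le> \<alpha>\<^sub>m\<close>, whereas R also asks for
  \<open>0 \<le> q i\<close>.\<close>

lemma fdp_le_credit:
  assumes "H \<subseteq> {1..n}" "0 < \<alpha>" "\<And>i. i \<in> {1..n} \<Longrightarrow> 0 \<le> q i"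
  defines "Rej \<equiv> rejections n \<alpha> \<alpha>\<^sub>m lam \<nu> x rule q"
  shows "real (card (Rej \<inter> H)) / real (max (card Rej) 1) \<le> \<alpha> * \<zeta> * (\<Sum>i\<in>H. credit i q)"
proof (cases "\<exists>t. stops_at q t")
  case False
  then have "Rej = {}" by (simp add: Rej_def rejections_def Let_def)
  then show ?thesis using assms(2) zeta_pos credit_nonneg by (simp add: sum_nonneg)
next
  case True
  let ?S = "final_mask q"
  let ?A = "real (num_A lam \<nu> q ?S)"
  have sub: "?S \<subseteq> {1..n}" unfolding final_mask_def by (rule mask_subset)
  have Rej: "Rej = {i \<in> ?S. 0 \<le> q i \<and> q i \<le> \<alpha>\<^sub>m}"
    using True sub assms(3)
    by (auto simp: Rej_def rejections_def Let_def final_mask_def stop_time_def)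
  have "stops \<alpha> \<alpha>\<^sub>m lam \<nu> q ?S"
    using True unfolding final_mask_def stop_time_def by (rule LeastI_ex)
  then have R: "0 < card Rej" "(1 + ?A) / (\<zeta> * real (card Rej)) \<le> \<alpha>"
    by (auto simp: stops_def fdp_hat_def num_R_def Rej)
  have "finite H" using assms(1) finite_subset by blast
  then have "(\<Sum>i\<in>H. credit i q) = (\<Sum>i\<in>Rej \<inter> H. 1 / (1 + ?A))"
    using True by (intro sum.mono_neutral_cong_right) (auto simp: credit_def Rej)
  also have "\<dots> = real (card (Rej \<inter> H)) / (1 + ?A)" by simp
  finally have c: "(\<Sum>i\<in>H. credit i q) = real (card (Rej \<inter> H)) / (1 + ?A)" .
  have "1 / real (card Rej) \<le> \<alpha> * \<zeta> / (1 + ?A)"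
    using R zeta_pos by (simp add: field_simps)
  from mult_left_mono[OF this, of "real (card (Rej \<inter> H))"] show ?thesis
    using R(1) by (simp add: c max_absorb1 Suc_le_eq mult_ac)
qed

section \<open>Measurability of masks, stopping and charges\<close>

abbreviation vectors :: "(nat \<Rightarrow> real) measure" where "vectors \<equiv> \<Pi>\<^sub>M i\<in>{1..n}. borel"

lemma measurable_num_A:
  assumes "S \<subseteq> {1..n}"
  shows "(\<lambda>q. num_A lam \<nu> q S) \<in> vectors \<rightarrow>\<^sub>M count_space UNIV"
proof -
  have f: "finite S" using assms finite_subset by blast
  have [measurable]: "(\<lambda>q. q i) \<in> borel_measurable vectors" if "i \<in> S" for i
    using that assms by (intro measurable_component_singleton) auto
  have "(\<lambda>q. num_A lam \<nu> q S) = (\<lambda>q. \<Sum>i\<in>S. if lam \<le> q i \<and> q i \<le> \<nu> then 1 else 0)"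
    using f by (simp add: num_A_def sum.If_cases Int_def)
  also have "\<dots> \<in> vectors \<rightarrow>\<^sub>M count_space UNIV" by measurable
  finally show ?thesis .
qed

lemma measurable_num_R:
  assumes "S \<subseteq> {1..n}"
  shows "(\<lambda>q. num_R \<alpha>\<^sub>m q S) \<in> vectors \<rightarrow>\<^sub>M count_space UNIV"
proof -
  have f: "finite S" using assms finite_subset by blast
  have [measurable]: "(\<lambda>q. q i) \<in> borel_measurable vectors" if "i \<in> S" for i
    using that assms by (intro measurable_component_singleton) auto
  have "(\<lambda>q. num_R \<alpha>\<^sub>m q S) = (\<lambda>q. \<Sum>i\<in>S. if 0 \<le> q i \<and> q i \<le> \<alpha>\<^sub>m then 1 else 0)"
    using f by (simp add: num_R_def sum.If_cases Int_def)
  also have "\<dots> \<in> vectors \<rightarrow>\<^sub>M count_space UNIV" by measurable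
  finally show ?thesis .
qed

lemma measurable_masking_fun: "reflect \<in> borel_measurable borel"
  unfolding masking_fun_def by measurable

text \<open>The assumption on the rule concerns fixed counts and a fixed set. The random counts take
  countably many values, so they can be substituted one after the other; \<open>S\<close> stays
  fixed until \<open>measurable_mask\<close>.\<close>

lemma measurable_next_mask:
  assumes "S \<subseteq> {1..n}" "S \<noteq> {}"
  shows "(\<lambda>q. rule t (restrict x {1..n}) (restrict (\<lambda>i. reflect (q i)) {1..n})
      (num_A lam \<nu> q S) (num_R \<alpha>\<^sub>m q S) S (restrict q ({1..n} - S)))
    \<in> vectors \<rightarrow>\<^sub>M count_space (Pow {1..n})"
proof -
  let ?g = "\<lambda>q. (restrict (\<lambda>i. reflect (q i)) {1..n}, restrict q ({1..n} - S))"
  let ?r = "\<lambda>A R. \<lambda>q. rule t (restrict x {1..n}) (fst (?g q)) A R S (snd (?g q))"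
  have "?g \<in> vectors \<rightarrow>\<^sub>M vectors \<Otimes>\<^sub>M (\<Pi>\<^sub>M i\<in>{1..n} - S. borel)"
    by (intro measurable_Pair measurable_restrict measurable_compose[OF _ measurable_masking_fun]
        measurable_component_singleton) auto
  moreover have "(\<lambda>(m, u). rule t (restrict x {1..n}) m A R S u)
      \<in> vectors \<Otimes>\<^sub>M (\<Pi>\<^sub>M i\<in>{1..n} - S. borel) \<rightarrow>\<^sub>M count_space {T. T \<subset> S}" for A R
    using adaptive assms unfolding adaptive_rule_def by blast
  ultimately have "?r A R \<in> vectors \<rightarrow>\<^sub>M count_space {T. T \<subset> S}" for A R
    unfolding split_beta by (rule measurable_compose)
  \<comment> \<open>The codomain is enlarged to one independent of \<open>S\<close>, so that
    \<open>S\<close> can later be made random.\<close>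
  moreover have "(\<lambda>T. T) \<in> count_space {T. T \<subset> S} \<rightarrow>\<^sub>M count_space (Pow {1..n})"
    using assms by (auto simp: measurable_count_space_eq1)
  ultimately have r: "?r A R \<in> vectors \<rightarrow>\<^sub>M count_space (Pow {1..n})" for A R
    by (rule measurable_compose)
  have "(\<lambda>q. ?r (num_A lam \<nu> q S) R q) \<in> vectors \<rightarrow>\<^sub>M count_space (Pow {1..n})" for R
    by (rule measurable_compose_countable[OF r measurable_num_A[OF assms(1)]])
  then have "(\<lambda>q. ?r (num_A lam \<nu> q S) (num_R \<alpha>\<^sub>m q S) q) \<in> vectors \<rightarrow>\<^sub>M count_space (Pow {1..n})"
    by (rule measurable_compose_countable[OF _ measurable_num_R[OF assms(1)]])
  then show ?thesis by (simp only: fst_conv snd_conv)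
qed

lemma measurable_mask: "(\<lambda>q. mask q t) \<in> vectors \<rightarrow>\<^sub>M count_space (Pow {1..n})"
proof (induction t)
  case 0
  have c: "(\<lambda>q. q i) \<in> borel_measurable vectors" if "i \<in> {1..n}" for i
    using that by (intro measurable_component_singleton) auto
  have "{q \<in> space vectors. initial_mask n \<alpha>\<^sub>m lam \<nu> q = T} \<in> sets vectors"
    if "T \<subseteq> {1..n}" for T
  proof -
    have "{q \<in> space vectors. initial_mask n \<alpha>\<^sub>m lam \<nu> q = T} =
        {q \<in> space vectors. \<forall>i\<in>{1..n}. (q i \<in> {0..\<alpha>\<^sub>m} \<union> {lam..\<nu>}) = (i \<in> T)}"
      using that by (auto simp: initial_mask_def)
    also have "\<dots> \<in> sets vectors"
      using c by measurable
    finally show ?thesis .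
  qed
  then show ?case
    by (auto simp: measurable_count_space_eq2 vimage_def Int_def conj_commute initial_mask_def)
next
  case (Suc t)
  have *: "(\<lambda>q. if S = {} then {} else rule t (restrict x {1..n})
      (restrict (\<lambda>i. reflect (q i)) {1..n})
      (num_A lam \<nu> q S) (num_R \<alpha>\<^sub>m q S) S (restrict q ({1..n} - S)))
    \<in> vectors \<rightarrow>\<^sub>M count_space (Pow {1..n})" if "S \<in> Pow {1..n}" for S
    using measurable_next_mask[of S t] that by (cases "S = {}") auto
  show ?case
    using measurable_compose_countable'[OF * Suc] by (simp add: Let_def countable_finite)
qed

lemma measurable_stops:
  assumes "S \<subseteq> {1..n}"
  shows "Measurable.pred vectors (\<lambda>q. stops \<alpha> \<alpha>\<^sub>m lam \<nu> q S)"
proof -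
  note measurable_num_A[OF assms, measurable] measurable_num_R[OF assms, measurable]
  show ?thesis unfolding stops_def fdp_hat_def by measurable
qed

lemma measurable_stops_at: "Measurable.pred vectors (\<lambda>q. stops_at q t)"
  by (rule measurable_compose_countable'[OF measurable_stops measurable_mask])
    (auto simp: countable_finite)

lemma measurable_final_mask: "final_mask \<in> vectors \<rightarrow>\<^sub>M count_space (Pow {1..n})"
  unfolding final_mask_def stop_time_def
  by (rule measurable_compose_countable[OF measurable_mask measurable_Least[OF measurable_stops_at]])

lemma measurable_credit:
  assumes "i \<in> {1..n}"
  shows "credit i \<in> borel_measurable vectors"
proof -
  have ex: "Measurable.pred vectors (\<lambda>q. \<exists>t. stops_at q t)"
    using measurable_stops_at by measurable
  have c: "(\<lambda>q. q i) \<in> borel_measurable vectors"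
    using assms by (intro measurable_component_singleton) auto
  have "(\<lambda>q. if (\<exists>t. stops_at q t) \<and> i \<in> S \<and> q i \<in> {0..\<alpha>\<^sub>m}
      then 1 / (1 + real (num_A lam \<nu> q S)) else 0) \<in> borel_measurable vectors"
    if "S \<in> Pow {1..n}" for S
  proof -
    have A: "(\<lambda>q. num_A lam \<nu> q S) \<in> vectors \<rightarrow>\<^sub>M count_space UNIV"
      using measurable_num_A that by blast
    have "(\<lambda>q. 1 / (1 + real (num_A lam \<nu> q S))) \<in> borel_measurable vectors"
      using A by measurable
    moreover have "Measurable.pred vectors (\<lambda>q. (\<exists>t. stops_at q t) \<and> i \<in> S \<and> q i \<in> {0..\<alpha>\<^sub>m})"
      using ex by (rule pred_intros_logic(3)) (use c in measurable)
    ultimately show ?thesis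
      by (intro measurable_If) (auto simp: pred_def)
  qed
  from measurable_compose_countable'[OF this measurable_final_mask] show ?thesis
    by (simp add: credit_def[abs_def] countable_finite)
qed

section \<open>Reflecting and resampling one null p-value under the integral\<close>

text \<open>
  The hypothesis on \<open>F\<close> enters because the reflection sends \<open>\<nu> - \<zeta> u \<ge> lam\<close> to
  \<open>u \<le> \<alpha>\<^sub>m \<le> lam\<close>; the factor \<open>\<zeta>\<close> is its Jacobian.
\<close>

lemma nn_integral_reflect:
  fixes F h :: "real \<Rightarrow> ennreal"
  assumes "\<nu> \<le> 1" and [measurable]: "F \<in> borel_measurable borel" "h \<in> borel_measurable borel"
    and mono: "mono_on {0..1} F" and supp: "\<And>u. u \<notin> {0..\<alpha>\<^sub>m} \<Longrightarrow> h u = 0"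
  shows "ennreal \<zeta> * (\<integral>\<^sup>+u. F u * h u \<partial>lborel)
    \<le> (\<integral>\<^sup>+u. F u * (indicator {lam<..\<nu>} u * h (reflect u)) \<partial>lborel)"
proof -
  note measurable_masking_fun[measurable]
  have F: "F u \<le> F v" if "0 \<le> u" "u \<le> v" "v \<le> 1" for u v
    using mono that by (auto simp: mono_on_def)
  have \<zeta>: "\<zeta> * \<alpha>\<^sub>m = \<nu> - lam" using alpha_m_pos by (simp add: zeta_def)
  have "(\<integral>\<^sup>+u. F u * (indicator {lam<..\<nu>} u * h (reflect u)) \<partial>lborel) =
      ennreal \<bar>- \<zeta>\<bar> * (\<integral>\<^sup>+u. F (\<nu> + - \<zeta> * u) * (indicator {lam<..\<nu>} (\<nu> + - \<zeta> * u) *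
        h (reflect (\<nu> + - \<zeta> * u))) \<partial>lborel)"
    using zeta_pos by (intro nn_integral_real_affine) auto
  moreover have "(\<integral>\<^sup>+u. F u * h u \<partial>lborel) \<le>
      (\<integral>\<^sup>+u. F (\<nu> + - \<zeta> * u) * (indicator {lam<..\<nu>} (\<nu> + - \<zeta> * u) *
        h (reflect (\<nu> + - \<zeta> * u))) \<partial>lborel)"
  proof (rule nn_integral_mono_AE)
    \<comment> \<open>At \<open>u = \<alpha>\<^sub>m\<close> the substituted point is
      \<open>lam\<close>, which the half-open interval excludes, so the inequality can fail there;
      that point is a null set.\<close>
    show "AE u in lborel. F u * h u \<le> F (\<nu> + - \<zeta> * u) *
        (indicator {lam<..\<nu>} (\<nu> + - \<zeta> * u) * h (reflect (\<nu> + - \<zeta> * u)))"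
      using AE_lborel_singleton[of "\<alpha>\<^sub>m"]
    proof eventually_elim
      case (elim u)
      show ?case
      proof (cases "u \<in> {0..<\<alpha>\<^sub>m}")
        case True
        then have "\<zeta> * u < \<nu> - lam" "0 \<le> \<zeta> * u"
          using zeta_pos mult_strict_left_mono[of u "\<alpha>\<^sub>m" \<zeta>] by (auto simp: \<zeta>)
        then have mem: "\<nu> + - \<zeta> * u \<in> {lam<..\<nu>}" by auto
        then have "reflect (\<nu> + - \<zeta> * u) = u"
          using zeta_pos by (simp add: reflect_upper(1))
        moreover have "F u \<le> F (\<nu> + - \<zeta> * u)"
          using True mem alpha_m_le assms(1) by (intro F) auto
        ultimately show ?thesis using mem by (simp add: mult_right_mono)
      next
        case False
        with elim supp[of u] show ?thesis by auto
      qed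
    qed
  qed
  ultimately show ?thesis using zeta_pos by (simp add: mult_left_mono)
qed

end

text \<open>The law of the whole vector is the product of the laws of the coordinates in
  \<open>H\<close> and the joint law of the block \<open>K\<close>. So coordinate \<open>i\<close>
  is independent of the rest, and drawing it afresh preserves the law.\<close>

lemma (in prob_space) nn_integral_resample:
  fixes p :: "'i \<Rightarrow> 'a \<Rightarrow> real" and g :: "('i \<Rightarrow> real) \<Rightarrow> ennreal"
  assumes "finite H" "i \<in> H" "H \<inter> K = {}"
    and indep: "indep_vars (\<lambda>_. borel) p H"
    and indep2: "indep_var (\<Pi>\<^sub>M j\<in>H. borel) (\<lambda>\<omega>. \<lambda>j\<in>H. p j \<omega>)
      (\<Pi>\<^sub>M j\<in>K. borel) (\<lambda>\<omega>. \<lambda>j\<in>K. p j \<omega>)"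
    and g: "g \<in> borel_measurable (\<Pi>\<^sub>M j\<in>H \<union> K. borel)"
  shows "(\<integral>\<^sup>+\<omega>. g (\<lambda>j\<in>H \<union> K. p j \<omega>) \<partial>M) =
    (\<integral>\<^sup>+\<omega>. \<integral>\<^sup>+u. g ((\<lambda>j\<in>H \<union> K. p j \<omega>)(i := u)) \<partial>distr M borel (p i) \<partial>M)"
proof -
  let ?X = "\<lambda>\<omega>. \<lambda>j\<in>H. p j \<omega>" and ?Y = "\<lambda>\<omega>. \<lambda>j\<in>K. p j \<omega>"
  let ?PX = "\<Pi>\<^sub>M j\<in>H. (borel :: real measure)" and ?PY = "\<Pi>\<^sub>M j\<in>K. (borel :: real measure)"
  let ?P = "\<Pi>\<^sub>M j\<in>H \<union> K. (borel :: real measure)"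
  \<comment> \<open>The value off \<open>H\<close> is a filler: \<open>product_prob_space\<close>
    wants a probability measure at every index.\<close>
  define D where "D j = distr M borel (if j \<in> H then p j else p i)" for j
  have p: "p j \<in> borel_measurable M" if "j \<in> H" for j
    using indep that by (auto simp: indep_vars_def)
  have D: "prob_space (D j)" for j
    unfolding D_def using p assms(2) by (intro prob_space_distr) auto
  interpret D: product_prob_space D
    by (intro product_prob_spaceI D)
  have sets_D: "sets (D j) = sets borel" for j by (simp add: D_def)
  have Di: "D i = distr M borel (p i)" using assms(2) by (simp add: D_def)
  have XY: "?X \<in> M \<rightarrow>\<^sub>M ?PX" "?Y \<in> M \<rightarrow>\<^sub>M ?PY"
    and joint: "distr M ?PX ?X \<Otimes>\<^sub>M distr M ?PY ?Y = distr M (?PX \<Otimes>\<^sub>M ?PY) (\<lambda>\<omega>. (?X \<omega>, ?Y \<omega>))"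
    using indep2 by (auto simp: indep_var_distribution_eq)
  have "distr M ?PX ?X = (\<Pi>\<^sub>M j\<in>H. distr M borel (p j))"
    using indep_vars_iff_distr_eq_PiM'[of H p "\<lambda>_. borel"] indep p assms(2) by auto
  also have "\<dots> = PiM H D" by (intro PiM_cong) (auto simp: D_def)
  finally have X: "distr M ?PX ?X = PiM H D" .
  let ?Q = "distr M ?PY ?Y"
  interpret Q: prob_space ?Q using XY(2) by (rule prob_space_distr)
  interpret X: prob_space "PiM H D" by (intro prob_space_PiM D)
  interpret XQ: pair_sigma_finite "PiM H D" ?Q ..
  have sets_PiM_D: "sets (PiM J D) = sets (\<Pi>\<^sub>M j\<in>J. borel)" for J
    by (intro sets_PiM_cong) (auto simp: sets_D)
  have merge: "merge H K \<in> PiM H D \<Otimes>\<^sub>M ?Q \<rightarrow>\<^sub>M ?P"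
    by (subst measurable_cong_sets[OF sets_pair_measure_cong[OF sets_PiM_D sets_distr] refl])
      (rule measurable_merge)
  \<comment> \<open>Fubini with coordinate \<open>i\<close> innermost; it is applied below both to
    \<open>g\<close> and to its resampled version \<open>?G\<close>.\<close>
  have key: "(\<integral>\<^sup>+\<omega>. f (\<lambda>j\<in>H \<union> K. p j \<omega>) \<partial>M) =
      (\<integral>\<^sup>+y. \<integral>\<^sup>+x. \<integral>\<^sup>+u. f (merge H K (x(i := u), y)) \<partial>D i \<partial>PiM (H - {i}) D \<partial>?Q)"
    if f: "f \<in> borel_measurable ?P" for f :: "('i \<Rightarrow> real) \<Rightarrow> ennreal"
  proof -
    have fm: "(\<lambda>z. f (merge H K z)) \<in> borel_measurable (PiM H D \<Otimes>\<^sub>M ?Q)"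
      using merge f by (rule measurable_compose)
    have fm': "(\<lambda>z. f (merge H K z)) \<in> borel_measurable (?PX \<Otimes>\<^sub>M ?PY)"
      using measurable_merge f by (rule measurable_compose)
    have "merge H K (?X \<omega>, ?Y \<omega>) = (\<lambda>j\<in>H \<union> K. p j \<omega>)" for \<omega>
      by (auto simp: merge_def restrict_def fun_eq_iff)
    then have "(\<integral>\<^sup>+\<omega>. f (\<lambda>j\<in>H \<union> K. p j \<omega>) \<partial>M) = (\<integral>\<^sup>+\<omega>. f (merge H K (?X \<omega>, ?Y \<omega>)) \<partial>M)"
      by simp
    also have "\<dots> = (\<integral>\<^sup>+z. f (merge H K z) \<partial>distr M (?PX \<Otimes>\<^sub>M ?PY) (\<lambda>\<omega>. (?X \<omega>, ?Y \<omega>)))"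
      using XY fm' by (subst nn_integral_distr) auto
    also have "\<dots> = (\<integral>\<^sup>+z. f (merge H K z) \<partial>(PiM H D \<Otimes>\<^sub>M ?Q))"
      by (simp only: joint[symmetric] X)
    also have "\<dots> = (\<integral>\<^sup>+y. \<integral>\<^sup>+x. f (merge H K (x, y)) \<partial>PiM H D \<partial>?Q)"
      by (rule XQ.nn_integral_snd[symmetric, OF fm])
    also have "\<dots> = (\<integral>\<^sup>+y. \<integral>\<^sup>+x. \<integral>\<^sup>+u. f (merge H K (x(i := u), y)) \<partial>D i \<partial>PiM (H - {i}) D \<partial>?Q)"
    proof (rule nn_integral_cong)
      fix y assume y: "y \<in> space ?Q"
      have "(\<lambda>x. f (merge H K (x, y))) \<in> borel_measurable (PiM H D)"
        using fm y by measurable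
      then show "(\<integral>\<^sup>+x. f (merge H K (x, y)) \<partial>PiM H D) =
          (\<integral>\<^sup>+x. \<integral>\<^sup>+u. f (merge H K (x(i := u), y)) \<partial>D i \<partial>PiM (H - {i}) D)"
        using D.product_nn_integral_insert[of "H - {i}" i "\<lambda>x. f (merge H K (x, y))"] assms(1,2)
        by (simp add: insert_absorb)
    qed
    finally show ?thesis .
  qed
  let ?G = "\<lambda>q. \<integral>\<^sup>+u. g (q(i := u)) \<partial>D i"
  have "(\<lambda>(q, u). q(i := u)) \<in> ?P \<Otimes>\<^sub>M borel \<rightarrow>\<^sub>M ?P"
    using measurable_add_dim[of i "H \<union> K" "\<lambda>_. borel"] assms(2) by (simp add: insert_absorb)
  then have "(\<lambda>z. g ((\<lambda>(q, u). q(i := u)) z)) \<in> borel_measurable (?P \<Otimes>\<^sub>M borel)"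
    using g by (rule measurable_compose)
  then have "(\<lambda>(q, u). g (q(i := u))) \<in> borel_measurable (?P \<Otimes>\<^sub>M D i)"
    by (simp add: split_beta' measurable_cong_sets[OF sets_pair_measure_cong[OF refl sets_D] refl])
  then have G: "?G \<in> borel_measurable ?P"
    by (rule D.M.borel_measurable_nn_integral)
  \<comment> \<open>In \<open>key\<close> for \<open>?G\<close> the second update overwrites the
    first, so the integrand is constant in \<open>u\<close> and \<open>u\<close> integrates to total
    mass 1.\<close>
  have upd: "(merge H K (x(i := u), y))(i := v) = merge H K (x(i := v), y)" for x y u v
    using assms(2) by (auto simp: merge_def fun_eq_iff)
  show ?thesis
    unfolding Di[symmetric] key[OF g] key[OF G] upd by (simp add: prob_space.emeasure_space_1[OF D])
qed

section \<open>Control of the false discovery rate in expectation\<close>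

theorem theorem2p1:
  fixes M :: "'w measure"
    and n :: nat
    and p :: "nat \<Rightarrow> 'w \<Rightarrow> real"
    and x :: "nat \<Rightarrow> 'x"
    and H0 :: "nat set"
    and \<alpha> \<alpha>\<^sub>m lam \<nu> :: real
    and rule :: "'x shrinking_rule"
  assumes "prob_space M"
    and "H0 \<subseteq> {1..n}"
    and "\<And>i. i \<in> {1..n} \<Longrightarrow> p i \<in> borel_measurable M"
    and "\<And>i. i \<in> {1..n} \<Longrightarrow> AE \<omega> in M. p i \<omega> \<in> {0..1}"
    and "prob_space.indep_vars M (\<lambda>_. borel) p H0"
    and "prob_space.indep_var M
           (\<Pi>\<^sub>M i\<in>H0. borel) (\<lambda>\<omega>. \<lambda>i\<in>H0. p i \<omega>)
           (\<Pi>\<^sub>M i\<in>{1..n} - H0. borel) (\<lambda>\<omega>. \<lambda>i\<in>{1..n} - H0. p i \<omega>)"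
    and "\<And>i. i \<in> H0 \<Longrightarrow> has_nondecreasing_density M (p i)"
    and "0 < \<alpha>\<^sub>m" and "\<alpha>\<^sub>m \<le> lam" and "lam < \<nu>" and "\<nu> \<le> 1"
    and "0 < \<alpha>" and "\<alpha> < 1"
    and "adaptive_rule n x rule"
  shows "FDR M H0 (\<lambda>\<omega>. rejections n \<alpha> \<alpha>\<^sub>m lam \<nu> x rule (\<lambda>i. p i \<omega>)) \<le> \<alpha>"
proof -
  interpret prob_space M by (rule assms(1))
  interpret masking_procedure n \<alpha> \<alpha>\<^sub>m lam \<nu> x rule
    by unfold_locales (use assms in auto)
  have H0: "finite H0" "\<And>i. i \<in> H0 \<Longrightarrow> i \<in> {1..n}" "H0 \<union> ({1..n} - H0) = {1..n}"
    using assms(2) finite_subset by auto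
  let ?q = "\<lambda>\<omega>. \<lambda>i\<in>{1..n}. p i \<omega>"
  let ?Rej = "\<lambda>\<omega>. rejections n \<alpha> \<alpha>\<^sub>m lam \<nu> x rule (\<lambda>i. p i \<omega>)"
  let ?c = "\<lambda>i q. ennreal (credit i q)"
  \<comment> \<open>The charge after reflecting an upper value; for every vector these sum to at
    most 1 over \<open>H0\<close>.\<close>
  let ?d = "\<lambda>i q. indicator {lam<..\<nu>} (q i) * ?c i (q(i := reflect (q i)))"
  have q: "?q \<in> M \<rightarrow>\<^sub>M vectors"
    using assms(3) by (intro measurable_restrict)
  have c: "?c i \<in> borel_measurable vectors" if "i \<in> H0" for i
    using measurable_credit H0(2)[OF that] by simp
  have upd: "(\<lambda>z. (fst z)(i := snd z)) \<in> vectors \<Otimes>\<^sub>M borel \<rightarrow>\<^sub>M vectors" if "i \<in> H0" for i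
    using measurable_add_dim[of i "{1..n}" "\<lambda>_. borel"]
    unfolding insert_absorb[OF H0(2)[OF that]] split_beta' .
  have comp: "(\<lambda>q. q i) \<in> borel_measurable vectors" if "i \<in> H0" for i
    using H0(2)[OF that] by (intro measurable_component_singleton) auto
  have d: "?d i \<in> borel_measurable vectors" if "i \<in> H0" for i
  proof -
    have "(\<lambda>q. (q, reflect (q i))) \<in> vectors \<rightarrow>\<^sub>M vectors \<Otimes>\<^sub>M borel"
      using comp[OF that] measurable_masking_fun by measurable
    from measurable_compose[OF measurable_compose[OF this upd[OF that]] c[OF that]] comp[OF that]
    show ?thesis by simp
  qed
  \<comment> \<open>Resampling isolates coordinate \<open>i\<close>, the one-dimensional inequality
    reflects it with all others fixed, and resampling is then undone.\<close>
  have single: "ennreal \<zeta> * (\<integral>\<^sup>+\<omega>. ?c i (?q \<omega>) \<partial>M) \<le> (\<integral>\<^sup>+\<omega>. ?d i (?q \<omega>) \<partial>M)" if i: "i \<in> H0" for i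
  proof -
    obtain f :: "real \<Rightarrow> ennreal" where f: "mono_on {0..1} f"
      "distributed M lborel (p i) (\<lambda>u. f u * indicator {0..1} u)"
      using assms(7)[OF i] by (auto simp: has_nondecreasing_density_def)
    \<comment> \<open>On the unit interval \<open>F\<close> agrees with \<open>f\<close> and so
      stays monotone there; the measurability provided by \<open>distributed\<close> is that of
      \<open>F\<close>.\<close>
    define F where "F u = f u * indicator {0..1} u" for u
    have F: "F \<in> borel_measurable borel" "mono_on {0..1} F"
      using f by (auto simp: distributed_def F_def[abs_def] mono_on_def)
    have "distr M borel (p i) = distr M lborel (p i)" by (rule distr_cong) auto
    then have law: "distr M borel (p i) = density lborel F"
      using f(2) by (simp add: distributed_def F_def[abs_def])
    have resample: "(\<integral>\<^sup>+\<omega>. g (?q \<omega>) \<partial>M) =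
        (\<integral>\<^sup>+\<omega>. \<integral>\<^sup>+u. g ((?q \<omega>)(i := u)) \<partial>distr M borel (p i) \<partial>M)"
      if "g \<in> borel_measurable vectors" for g :: "(nat \<Rightarrow> real) \<Rightarrow> ennreal"
      using nn_integral_resample[OF H0(1) i _ assms(5,6), of g] that unfolding H0(3) by blast
    have density: "(\<integral>\<^sup>+u. g ((?q \<omega>)(i := u)) \<partial>distr M borel (p i)) =
        (\<integral>\<^sup>+u. F u * g ((?q \<omega>)(i := u)) \<partial>lborel)"
      and gm: "(\<lambda>u. g ((?q \<omega>)(i := u))) \<in> borel_measurable borel"
      if "g \<in> borel_measurable vectors" for g :: "(nat \<Rightarrow> real) \<Rightarrow> ennreal" and \<omega>
    proof -
      have "?q \<omega> \<in> space vectors" by (simp add: space_PiM)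
      then have "(\<lambda>u. (?q \<omega>, u)) \<in> borel \<rightarrow>\<^sub>M vectors \<Otimes>\<^sub>M borel" by simp
      from measurable_compose[OF measurable_compose[OF this upd[OF i]] that]
      show gm: "(\<lambda>u. g ((?q \<omega>)(i := u))) \<in> borel_measurable borel" by simp
      show "(\<integral>\<^sup>+u. g ((?q \<omega>)(i := u)) \<partial>distr M borel (p i)) =
          (\<integral>\<^sup>+u. F u * g ((?q \<omega>)(i := u)) \<partial>lborel)"
        unfolding law using F(1) gm by (intro nn_integral_density) auto
    qed
    have "ennreal \<zeta> * (\<integral>\<^sup>+\<omega>. ?c i (?q \<omega>) \<partial>M) =
        ennreal \<zeta> * (\<integral>\<^sup>+\<omega>. \<integral>\<^sup>+u. F u * ?c i ((?q \<omega>)(i := u)) \<partial>lborel \<partial>M)"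
      unfolding resample[OF c[OF i]] density[OF c[OF i]] ..
    also have "\<dots> \<le> (\<integral>\<^sup>+\<omega>. ennreal \<zeta> * (\<integral>\<^sup>+u. F u * ?c i ((?q \<omega>)(i := u)) \<partial>lborel) \<partial>M)"
    proof -
      have "(\<lambda>z. (?q (fst z), snd z)) \<in> M \<Otimes>\<^sub>M lborel \<rightarrow>\<^sub>M vectors \<Otimes>\<^sub>M borel"
        using q by measurable
      from measurable_compose[OF measurable_compose[OF this upd[OF i]] c[OF i]] F(1)
      have "(\<lambda>(\<omega>, u). F u * ?c i ((?q \<omega>)(i := u))) \<in> borel_measurable (M \<Otimes>\<^sub>M lborel)"
        by (simp add: split_beta')
      then have "(\<lambda>\<omega>. \<integral>\<^sup>+u. F u * ?c i ((?q \<omega>)(i := u)) \<partial>lborel) \<in> borel_measurable M"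
        by (rule lborel.borel_measurable_nn_integral)
      then show ?thesis by (simp add: nn_integral_cmult)
    qed
    also have "\<dots> \<le> (\<integral>\<^sup>+\<omega>. \<integral>\<^sup>+u. F u * (indicator {lam<..\<nu>} u *
        ?c i ((?q \<omega>)(i := reflect u))) \<partial>lborel \<partial>M)"
      using assms(11) F gm[OF c[OF i]]
      by (intro nn_integral_mono nn_integral_reflect) (auto simp: credit_def)
    also have "\<dots> = (\<integral>\<^sup>+\<omega>. \<integral>\<^sup>+u. F u * ?d i ((?q \<omega>)(i := u)) \<partial>lborel \<partial>M)"
      by simp
    also have "\<dots> = (\<integral>\<^sup>+\<omega>. ?d i (?q \<omega>) \<partial>M)"
      unfolding resample[OF d[OF i]] density[OF d[OF i]] ..
    finally show ?thesis .
  qed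
  \<comment> \<open>The nonnegativity required by \<open>fdp_le_credit\<close> holds only almost
    surely.\<close>
  have "AE \<omega> in M. \<forall>i\<in>{1..n}. p i \<omega> \<in> {0..1}"
    using assms(4) by (intro AE_finite_allI) auto
  then have AE: "AE \<omega> in M. ennreal (real (card (?Rej \<omega> \<inter> H0)) / real (max (card (?Rej \<omega>)) 1))
      \<le> ennreal \<alpha> * (\<Sum>i\<in>H0. ennreal \<zeta> * ?c i (?q \<omega>))"
  proof eventually_elim
    case (elim \<omega>)
    have c: "credit i (?q \<omega>) = credit i (\<lambda>i. p i \<omega>)" for i by (rule credit_cong) simp
    have "(\<Sum>i\<in>H0. ennreal \<zeta> * ?c i (?q \<omega>)) =
        (\<Sum>i\<in>H0. ennreal (\<zeta> * credit i (\<lambda>i. p i \<omega>)))"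
      unfolding c using zeta_pos by (intro sum.cong refl ennreal_mult'[symmetric]) simp
    also have "\<dots> = ennreal (\<zeta> * (\<Sum>i\<in>H0. credit i (\<lambda>i. p i \<omega>)))"
      unfolding sum_distrib_left using zeta_pos credit_nonneg by (intro sum_ennreal) simp
    finally have "ennreal \<alpha> * (\<Sum>i\<in>H0. ennreal \<zeta> * ?c i (?q \<omega>)) =
        ennreal (\<alpha> * \<zeta> * (\<Sum>i\<in>H0. credit i (\<lambda>i. p i \<omega>)))"
      using assms(12) by (simp only: ennreal_mult' mult.assoc less_imp_le)
    then show ?case
      using fdp_le_credit[of H0 "\<lambda>i. p i \<omega>"] elim assms(2,12) by (simp add: ennreal_leI)
  qed
  \<comment> \<open>This comparison and the final \<open>integral_real_bounded\<close> work without
    measurability of the false discovery proportion; only the charges are shown measurable.\<close>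
  have "(\<integral>\<^sup>+\<omega>. ennreal (real (card (?Rej \<omega> \<inter> H0)) / real (max (card (?Rej \<omega>)) 1)) \<partial>M)
      \<le> (\<integral>\<^sup>+\<omega>. ennreal \<alpha> * (\<Sum>i\<in>H0. ennreal \<zeta> * ?c i (?q \<omega>)) \<partial>M)"
    by (rule nn_integral_mono_AE[OF AE])
  also have "\<dots> = ennreal \<alpha> * (\<Sum>i\<in>H0. ennreal \<zeta> * (\<integral>\<^sup>+\<omega>. ?c i (?q \<omega>) \<partial>M))"
    using measurable_compose[OF q c]
    by (simp add: nn_integral_cmult nn_integral_sum)
  also have "\<dots> \<le> ennreal \<alpha> * (\<Sum>i\<in>H0. \<integral>\<^sup>+\<omega>. ?d i (?q \<omega>) \<partial>M)"
    by (intro mult_left_mono sum_mono single) auto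
  also have "\<dots> = ennreal \<alpha> * (\<integral>\<^sup>+\<omega>. (\<Sum>i\<in>H0. ?d i (?q \<omega>)) \<partial>M)"
    using measurable_compose[OF q d] by (subst nn_integral_sum) auto
  also have "\<dots> \<le> ennreal \<alpha> * (\<integral>\<^sup>+\<omega>. 1 \<partial>M)"
  proof (intro mult_left_mono nn_integral_mono)
    have "(\<Sum>i\<in>H0. ?d i q) \<le> 1" for q
    proof -
      have "?d i q = ennreal (indicator {lam<..\<nu>} (q i) * credit i (q(i := reflect (q i))))" for i
        by (simp add: indicator_def)
      then have "(\<Sum>i\<in>H0. ?d i q) =
          ennreal (\<Sum>i\<in>H0. indicator {lam<..\<nu>} (q i) * credit i (q(i := reflect (q i))))"
        using credit_nonneg by simp
      also have "\<dots> \<le> 1"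
        using sum_reflected_credit_le_1[OF H0(1)] by (simp add: ennreal_leI flip: ennreal_1)
      finally show ?thesis .
    qed
    then show "(\<Sum>i\<in>H0. ?d i (?q \<omega>)) \<le> 1" for \<omega> .
  qed simp
  finally show ?thesis
    using assms(12) unfolding FDR_def
    by (intro integral_real_bounded) (auto simp: emeasure_space_1)
qed

end
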